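(* Let $R$ be a Noetherian commutative ring and let $M,N$ be finitely generated $R$-modules with $N\neq0$. Then the limit $$\lim_{r\to\infty}\frac1r\operatorname{surj}_N(M^{\oplus r})$$ exists.
   Context: For finitely generated $R$-modules $M,N$, $\operatorname{surj}_N(M):=\sup\{n\in\mathbb Z_{\ge0}\mid\text{there is a surjective } R\text{-linear map } M\to N^{\oplus n}\}$, which is a non-negative integer when $N\ne 0$. The limit, called the asymptotic surjective number of $M$ with respect to $N$, is over integers $r\ge1$. *)

theory Defs
  imports "HOL-Library.Extended_Real" "HOL-Algebra.Module" "HOL-Algebra.Ring_Divisibility"
begin

text \<open>The set of \<open>R\<close>-linear maps from \<open>M\<close> to \<open>N\<close>. As usual in HOL-Algebra, the values
  of such a map outside \<open>carrier M\<close> are irrelevant.\<close>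

definition linear_maps ::
  "('a, 'r) ring_scheme \<Rightarrow> ('a, 'b, 'm) module_scheme \<Rightarrow> ('a, 'c, 'n) module_scheme \<Rightarrow> ('b \<Rightarrow> 'c) set"
  where "linear_maps R M N =
    {f \<in> hom (add_monoid M) (add_monoid N).
      \<forall>a\<in>carrier R. \<forall>x\<in>carrier M. f (a \<odot>\<^bsub>M\<^esub> x) = a \<odot>\<^bsub>N\<^esub> f x}"

definition submodule_generated ::
  "('a, 'r) ring_scheme \<Rightarrow> ('a, 'b, 'm) module_scheme \<Rightarrow> 'b set \<Rightarrow> 'b set"
  where "submodule_generated R M A = \<Inter>{H. submodule H R M \<and> A \<subseteq> H}"

definition finitely_generated_module ::
  "('a, 'r) ring_scheme \<Rightarrow> ('a, 'b, 'm) module_scheme \<Rightarrow> bool"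
  where "finitely_generated_module R M \<longleftrightarrow>
    (\<exists>A. finite A \<and> A \<subseteq> carrier M \<and> carrier M = submodule_generated R M A)"

text \<open>The direct sum of \<open>n\<close> copies of \<open>M\<close>, with \<open>n\<close>-tuples as extensional functions on
  \<open>{..<n}\<close>. The record type of modules extends that of rings, so the fields \<open>mult\<close> and \<open>one\<close>
  have to be given as well, but no module notion refers to them.\<close>

definition module_power :: "('a, 'b, 'm) module_scheme \<Rightarrow> nat \<Rightarrow> ('a, nat \<Rightarrow> 'b) module"
  where "module_power M n =
    \<lparr>carrier = {..<n} \<rightarrow>\<^sub>E carrier M,
     monoid.mult = (\<lambda>x y. \<lambda>i\<in>{..<n}. x i \<otimes>\<^bsub>M\<^esub> y i),
     one = (\<lambda>i\<in>{..<n}. \<one>\<^bsub>M\<^esub>),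
     zero = (\<lambda>i\<in>{..<n}. \<zero>\<^bsub>M\<^esub>),
     add = (\<lambda>x y. \<lambda>i\<in>{..<n}. x i \<oplus>\<^bsub>M\<^esub> y i),
     smult = (\<lambda>a x. \<lambda>i\<in>{..<n}. a \<odot>\<^bsub>M\<^esub> x i)\<rparr>"

lemma module_module_power:
  assumes "module R M"
  shows "module R (module_power M n)"
proof -
  interpret module R M by fact
  show ?thesis
  proof (rule moduleI)
    show "cring R" ..
    show "abelian_group (module_power M n)"
    proof (rule abelian_groupI)
      fix x assume x: "x \<in> carrier (module_power M n)"
      show "\<exists>y\<in>carrier (module_power M n).
          y \<oplus>\<^bsub>module_power M n\<^esub> x = \<zero>\<^bsub>module_power M n\<^esub>"
        using x
        by (intro bexI[of _ "\<lambda>i\<in>{..<n}. \<ominus>\<^bsub>M\<^esub> x i"])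
          (auto simp: module_power_def PiE_iff M.l_neg intro!: ext)
    qed (auto simp: module_power_def PiE_iff M.a_ac extensional_def intro!: ext)
  qed (auto simp: module_power_def PiE_iff smult_l_distr smult_r_distr smult_assoc1 extensional_def
      intro!: ext)
qed

text \<open>The supremum is taken in \<^typ>\<open>enat\<close>, so that it is meaningful even if the set is
  unbounded (as it is for \<open>N = 0\<close>).\<close>

definition surj_number ::
  "('a, 'r) ring_scheme \<Rightarrow> ('a, 'c, 'n) module_scheme \<Rightarrow> ('a, 'b, 'm) module_scheme \<Rightarrow> enat"
  where "surj_number R N M =
    Sup {enat n | n. \<exists>f\<in>linear_maps R M (module_power N n).
      f ` carrier M = carrier (module_power N n)}"

end

(* Surjections M^r -> N^n and M^s -> N^m add up to a surjection M^(r+s) -> N^(n+m), so the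
   surjective number of M^r is superadditive in r and Fekete's argument gives convergence once it
   is O(r).
   For the bound choose a maximal proper submodule H of N: if M has k generators, then a surjection
   M^r -> N^n makes (N/H)^n, which is an n-dimensional vector space over the field acting on the
   simple module N/H, spanned by r k vectors, so n <= r k. Quotients are avoided by working with
   congruences modulo H. *)

theory Submission
  imports Defs
begin

section \<open>Fekete's lemma for sequences of linear growth\<close>

text \<open>The limit is the supremum of \<open>a r / r\<close> over \<open>r \<ge> 1\<close>,
  finite by \<open>bound\<close>. A single index \<open>m\<close> whose quotient nearly attains it
  controls all large \<open>r\<close>, which split into blocks of length \<open>m\<close> and a
  short remainder.\<close>

lemma superadditive_convergent:
  fixes a :: "nat \<Rightarrow> nat"
  assumes superadd: "\<And>r s. a r + a s \<le> a (r + s)" and bound: "\<And>r. a r \<le> r * C"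
  shows "\<exists>L. (\<lambda>r. real (a r) / real r) \<longlonglongrightarrow> L"
proof -
  define L where "L = (SUP r\<in>{1..}. real (a r) / real r)"
  have le_C: "real (a r) / real r \<le> real C" if "r \<ge> 1" for r
    using bound[of r] that by (simp add: divide_simps mult.commute flip: of_nat_mult)
  hence bdd: "bdd_above ((\<lambda>r. real (a r) / real r) ` {1..})"
    by (auto intro!: bdd_aboveI)
  have upper: "real (a r) / real r \<le> L" if "r \<ge> 1" for r
    unfolding L_def using that by (intro cSUP_upper bdd) auto
  have mult: "q * a m \<le> a (q * m)" for q m
  proof (induction q)
    case (Suc q)
    thus ?case using superadd[of m "q * m"] by simp
  qed simp
  have "(\<lambda>r. real (a r) / real r) \<longlonglongrightarrow> L"
  proof (rule order_tendstoI)
    fix y assume "y > L"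
    show "\<forall>\<^sub>F r in sequentially. real (a r) / real r < y"
      using eventually_ge_at_top[of 1] by eventually_elim (use upper \<open>y > L\<close> in force)
  next
    fix y assume "y < L"
    \<comment> \<open>It suffices to bound \<open>a r / r\<close> below by
      \<open>t - a m / r\<close> with \<open>t = a m / m\<close>, since this tends to
      \<open>t > y\<close>.\<close>
    then obtain m where m: "m \<ge> 1" and ym: "y < real (a m) / real m"
      unfolding L_def using less_cSUP_iff[OF _ bdd, of y] by auto
    define t where "t = real (a m) / real m"
    have t: "t * real m = real (a m)" "t \<ge> 0" using m by (auto simp: t_def)
    have "(\<lambda>r. t - real (a m) / real r) \<longlonglongrightarrow> t - 0"
      by (intro tendsto_intros tendsto_divide_0[OF tendsto_const] filterlim_real_sequentially
          filterlim_at_top_imp_at_infinity)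
    hence "\<forall>\<^sub>F r in sequentially. y < t - real (a m) / real r"
      using ym by (intro order_tendstoD) (auto simp: t_def)
    thus "\<forall>\<^sub>F r in sequentially. y < real (a r) / real r"
      using eventually_gt_at_top[of 0]
    proof eventually_elim
      case (elim r)
      \<comment> \<open>The remainder is at most one further block and so costs at most
        \<open>t * m = a m\<close>; the summand \<open>a (r mod m)\<close> from superadditivity is
        dropped because it is nonnegative.\<close>
      have "r = (r div m) * m + r mod m" by simp
      hence "real r = real (r div m) * real m + real (r mod m)"
        by (metis of_nat_add of_nat_mult)
      moreover have "real (r mod m) \<le> real m" using m by simp
      ultimately have "t * real r \<le> t * (real (r div m) * real m + real m)"
        using t(2) by (intro mult_left_mono) auto
      also have "\<dots> = real (r div m * a m) + real (a m)"
        using t(1) by (simp add: algebra_simps)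
      also have "r div m * a m \<le> a (r div m * m + r mod m)"
        using mult[of "r div m" m] superadd[of "r div m * m" "r mod m"] by linarith
      finally have "t * real r \<le> real (a r) + real (a m)" by simp
      hence "t \<le> (real (a r) + real (a m)) / real r"
        using elim(2) by (simp add: pos_le_divide_eq)
      hence "t - real (a m) / real r \<le> real (a r) / real r"
        by (simp add: add_divide_distrib)
      with elim(1) show ?case by simp
    qed
  qed
  thus ?thesis ..
qed

section \<open>Existence of a maximal proper submodule\<close>

text \<open>Zorn's lemma for proper submodules: \<open>{\<zero>}\<close> is one of them because
  \<open>N\<close> is nonzero, and finite generation keeps unions of chains proper.\<close>

lemma ex_maximal_submodule:
  assumes "module R N" and fg: "finitely_generated_module R N"
    and nz: "carrier N \<noteq> {\<zero>\<^bsub>N\<^esub>}"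
  obtains H where "submodule H R N" "H \<noteq> carrier N"
    "\<And>K. submodule K R N \<Longrightarrow> H \<subset> K \<Longrightarrow> K = carrier N"
proof -
  interpret module R N by fact
  obtain A where A: "finite A" "A \<subseteq> carrier N" "carrier N = submodule_generated R N A"
    using fg by (auto simp: finitely_generated_module_def)
  let ?P = "{H. submodule H R N \<and> H \<noteq> carrier N}"
  have "submodule {\<zero>\<^bsub>N\<^esub>} R N" by (rule submoduleI) auto
  hence "?P \<noteq> {}" using nz by auto
  moreover have "\<Union>\<C> \<in> ?P" if ne: "\<C> \<noteq> {}" and ch: "subset.chain ?P \<C>" for \<C>
  proof -
    have sub: "submodule H R N" "H \<noteq> carrier N" if "H \<in> \<C>" for H
      using ch that by (auto simp: subset.chain_def)
    have join: "\<exists>H\<in>\<C>. {x, y} \<subseteq> H" if "x \<in> \<Union>\<C>" "y \<in> \<Union>\<C>" for x y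
      using finite_subset_Union_chain[OF _ _ ne ch, of "{x, y}"] that by blast
    have "submodule (\<Union>\<C>) R N"
    proof (rule submoduleI)
      show "\<Union>\<C> \<subseteq> carrier N" using submoduleE(1)[OF sub(1)] by blast
      show "\<zero>\<^bsub>N\<^esub> \<in> \<Union>\<C>"
        using ne sub(1) by (metis all_not_in_conv Union_iff submodule.axioms(1) subgroup.one_closed
            monoid.simps(2))
      show "x \<oplus>\<^bsub>N\<^esub> y \<in> \<Union>\<C>" if "x \<in> \<Union>\<C>" "y \<in> \<Union>\<C>" for x y
        using join[OF that] submoduleE(5)[OF sub(1)] by blast
    qed (use submoduleE(3,4)[OF sub(1)] in blast)+
    moreover have "\<Union>\<C> \<noteq> carrier N"
    proof
      \<comment> \<open>The finitely many generators would all lie in one member of the chain, which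
        would then be all of \<open>N\<close>.\<close>
      assume "\<Union>\<C> = carrier N"
      then obtain B where B: "B \<in> \<C>" "A \<subseteq> B"
        using finite_subset_Union_chain[OF A(1) _ ne ch] A(2) by metis
      hence "carrier N \<subseteq> B" using A(3) sub(1) by (auto simp: submodule_generated_def)
      thus False using sub[OF B(1)] submoduleE(1) by blast
    qed
    ultimately show ?thesis by simp
  qed
  ultimately obtain H where "H \<in> ?P" "\<forall>X\<in>?P. H \<subseteq> X \<longrightarrow> X = H"
    using subset_Zorn_nonempty[of ?P] by auto
  thus ?thesis using that[of H] by blast
qed

section \<open>Linear algebra in the simple module \<open>N / H\<close>\<close>

text \<open>Membership in \<open>H\<close> plays the role of being zero in \<open>N / H\<close>;
  maximality of \<open>H\<close> expresses that this quotient is simple.\<close>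

locale maximal_submodule = module R N for R (structure) and N (structure) +
  fixes H
  assumes sub: "submodule H R N"
    and proper: "H \<noteq> carrier N"
    and maximal: "\<And>K. submodule K R N \<Longrightarrow> H \<subset> K \<Longrightarrow> K = carrier N"
begin

lemma mem_carrier [simp]: "x \<in> H \<Longrightarrow> x \<in> carrier N"
  using submoduleE(1)[OF sub] by blast

lemma closed [simp]:
  "\<zero>\<^bsub>N\<^esub> \<in> H" "x \<in> H \<Longrightarrow> y \<in> H \<Longrightarrow> x \<oplus>\<^bsub>N\<^esub> y \<in> H"
  "x \<in> H \<Longrightarrow> \<ominus>\<^bsub>N\<^esub> x \<in> H" "a \<in> carrier R \<Longrightarrow> x \<in> H \<Longrightarrow> a \<odot>\<^bsub>N\<^esub> x \<in> H"
  using submoduleE[OF sub] submodule.axioms(1)[OF sub] subgroup.one_closed by fastforce+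

lemma add_mem_cancel:
  assumes "x \<in> H" "y \<in> carrier N" "x \<oplus>\<^bsub>N\<^esub> y \<in> H"
  shows "y \<in> H"
proof -
  have "y = \<ominus>\<^bsub>N\<^esub> x \<oplus>\<^bsub>N\<^esub> (x \<oplus>\<^bsub>N\<^esub> y)"
    using assms by (simp add: M.r_neg1)
  thus ?thesis using assms by (metis closed(2,3))
qed

text \<open>Every nonzero element of a simple module generates it: \<open>R x + H\<close> is a
  submodule strictly larger than \<open>H\<close>, so maximality makes it all of
  \<open>N\<close>.\<close>

lemma ex_eq_smult_add:
  assumes x: "x \<in> carrier N" "x \<notin> H" and y: "y \<in> carrier N"
  shows "\<exists>c\<in>carrier R. \<exists>h\<in>H. y = c \<odot>\<^bsub>N\<^esub> x \<oplus>\<^bsub>N\<^esub> h"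
proof -
  let ?K = "{c \<odot>\<^bsub>N\<^esub> x \<oplus>\<^bsub>N\<^esub> h | c h. c \<in> carrier R \<and> h \<in> H}"
  have "submodule ?K R N"
  proof (rule submoduleI)
    show "?K \<subseteq> carrier N" using x by auto
    show "\<zero>\<^bsub>N\<^esub> \<in> ?K"
      using x by (intro CollectI exI[of _ \<zero>] exI[of _ "\<zero>\<^bsub>N\<^esub>"]) auto
  next
    fix z assume "z \<in> ?K"
    then obtain c h where z: "z = c \<odot>\<^bsub>N\<^esub> x \<oplus>\<^bsub>N\<^esub> h" "c \<in> carrier R" "h \<in> H" by auto
    show "\<ominus>\<^bsub>N\<^esub> z \<in> ?K"
      using x z by (intro CollectI exI[of _ "\<ominus> c"] exI[of _ "\<ominus>\<^bsub>N\<^esub> h"])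
        (auto simp: smult_l_minus M.minus_add)
    show "a \<odot>\<^bsub>N\<^esub> z \<in> ?K" if "a \<in> carrier R" for a
      using x z that by (intro CollectI exI[of _ "a \<otimes> c"] exI[of _ "a \<odot>\<^bsub>N\<^esub> h"])
        (auto simp: smult_r_distr smult_assoc1)
    fix z' assume "z' \<in> ?K"
    then obtain c' h' where z': "z' = c' \<odot>\<^bsub>N\<^esub> x \<oplus>\<^bsub>N\<^esub> h'" "c' \<in> carrier R" "h' \<in> H" by auto
    show "z \<oplus>\<^bsub>N\<^esub> z' \<in> ?K"
      using x z z' by (intro CollectI exI[of _ "c \<oplus> c'"] exI[of _ "h \<oplus>\<^bsub>N\<^esub> h'"])
        (auto simp: smult_l_distr M.a_ac)
  qed
  moreover have "h \<in> ?K" if "h \<in> H" for h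
    using x that by (intro CollectI exI[of _ \<zero>] exI[of _ h]) auto
  moreover have "x \<in> ?K"
    using x by (intro CollectI exI[of _ \<one>] exI[of _ "\<zero>\<^bsub>N\<^esub>"]) auto
  ultimately have "?K = carrier N" using x by (intro maximal) auto
  hence "y \<in> ?K" using y by (simp only:)
  thus ?thesis by blast
qed

text \<open>Commutativity of \<open>R\<close> enters here: the annihilator of a nonzero element of the simple module
  \<open>N / H\<close> annihilates all of \<open>N / H\<close>.\<close>

lemma smult_mem_all:
  assumes x: "x \<in> carrier N" "x \<notin> H" and b: "b \<in> carrier R" "b \<odot>\<^bsub>N\<^esub> x \<in> H"
    and y: "y \<in> carrier N"
  shows "b \<odot>\<^bsub>N\<^esub> y \<in> H"
proof -
  obtain c h where c: "c \<in> carrier R" "h \<in> H" "y = c \<odot>\<^bsub>N\<^esub> x \<oplus>\<^bsub>N\<^esub> h"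
    using ex_eq_smult_add[OF x y] by auto
  have "b \<odot>\<^bsub>N\<^esub> y = c \<odot>\<^bsub>N\<^esub> (b \<odot>\<^bsub>N\<^esub> x) \<oplus>\<^bsub>N\<^esub> b \<odot>\<^bsub>N\<^esub> h"
    using c b x by (simp add: smult_r_distr R.m_comm flip: smult_assoc1)
  thus ?thesis using b c by simp
qed

text \<open>The pivot operation of the elimination: a multiple of an element that is nonzero modulo
  \<open>H\<close> cancels any given element modulo \<open>H\<close>.\<close>

lemma ex_smult_add_mem:
  assumes x: "x \<in> carrier N" "x \<notin> H" and y: "y \<in> carrier N"
  shows "\<exists>c\<in>carrier R. y \<oplus>\<^bsub>N\<^esub> c \<odot>\<^bsub>N\<^esub> x \<in> H"
proof -
  obtain c h where c: "c \<in> carrier R" "h \<in> H" "y = c \<odot>\<^bsub>N\<^esub> x \<oplus>\<^bsub>N\<^esub> h"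
    using ex_eq_smult_add[OF x y] by auto
  have "y \<oplus>\<^bsub>N\<^esub> (\<ominus> c) \<odot>\<^bsub>N\<^esub> x = h"
    using c x by (simp add: smult_l_minus M.a_ac M.r_neg)
  thus ?thesis using c by (intro bexI[of _ "\<ominus> c"]) auto
qed

lemma finsum_mem:
  assumes "f \<in> J \<rightarrow> H"
  shows "(\<Oplus>\<^bsub>N\<^esub>j\<in>J. f j) \<in> H"
proof (cases "finite J")
  case True
  thus ?thesis using assms
  proof (induction J)
    case (insert j J)
    hence "f \<in> J \<rightarrow> carrier N" "f j \<in> carrier N" by (auto simp: Pi_iff)
    thus ?case using insert by auto
  qed auto
\<comment> \<open>Over an infinite index set \<open>finsum\<close> defaults to zero, which lies in
  \<open>H\<close>.\<close>
qed (simp add: M.finsum_infinite)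

text \<open>Gaussian elimination over the field that acts on \<open>N / H\<close>: one vector \<open>v j\<^sub>0\<close> clears the
  last coordinate of all the others.\<close>

lemma card_ge_if_spanning:
  assumes "finite J" "\<And>j k. j \<in> J \<Longrightarrow> k < n \<Longrightarrow> v j k \<in> carrier N"
    and "\<And>u. (\<And>k. k < n \<Longrightarrow> u k \<in> carrier N) \<Longrightarrow>
      \<exists>a\<in>J \<rightarrow> carrier R. \<forall>k<n. \<exists>h\<in>H. u k = (\<Oplus>\<^bsub>N\<^esub>j\<in>J. a j \<odot>\<^bsub>N\<^esub> v j k) \<oplus>\<^bsub>N\<^esub> h"
  shows "n \<le> card J"
  using assms
proof (induction n arbitrary: J v)
  case (Suc n)
  note finJ = Suc.prems(1) and vcl = Suc.prems(2) and span = Suc.prems(3)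
  \<comment> \<open>A pivot exists: otherwise the last coordinate of every combination lies in
    \<open>H\<close>, and spanning the constant vectors would force \<open>H\<close> to be all of
    \<open>N\<close>.\<close>
  have "\<exists>j0\<in>J. v j0 n \<notin> H"
  proof (rule ccontr)
    assume "\<not> ?thesis"
    hence all: "v j n \<in> H" if "j \<in> J" for j using that by blast
    have "y \<in> H" if y: "y \<in> carrier N" for y
    proof -
      obtain a h where "a \<in> J \<rightarrow> carrier R" "h \<in> H"
        "y = (\<Oplus>\<^bsub>N\<^esub>j\<in>J. a j \<odot>\<^bsub>N\<^esub> v j n) \<oplus>\<^bsub>N\<^esub> h"
        using span[of "\<lambda>_. y"] y by auto
      thus ?thesis using all by (auto intro!: closed finsum_mem)
    qed
    thus False using proper mem_carrier by blast
  qed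
  then obtain j0 where j0: "j0 \<in> J" "v j0 n \<notin> H" ..
  define w where "w = v j0"
  define J' where "J' = J - {j0}"
  have J': "finite J'" "j0 \<notin> J'" "J = insert j0 J'" using finJ j0 by (auto simp: J'_def)
  have wcl: "w k \<in> carrier N" if "k \<le> n" for k using vcl j0 that by (simp add: w_def)
  have vcl': "v j k \<in> carrier N" if "j \<in> J'" "k \<le> n" for j k using vcl that J' by auto
  have "\<exists>c\<in>carrier R. v j n \<oplus>\<^bsub>N\<^esub> c \<odot>\<^bsub>N\<^esub> w n \<in> H" if "j \<in> J'" for j
    using that j0 wcl vcl' by (intro ex_smult_add_mem) (auto simp: w_def)
  then obtain c where c: "\<And>j. j \<in> J' \<Longrightarrow> c j \<in> carrier R"
    "\<And>j. j \<in> J' \<Longrightarrow> v j n \<oplus>\<^bsub>N\<^esub> c j \<odot>\<^bsub>N\<^esub> w n \<in> H" by metis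
  \<comment> \<open>The reduced vectors, whose coordinate \<open>n\<close> vanishes modulo
    \<open>H\<close> by the choice of \<open>c\<close>.\<close>
  define v' where "v' = (\<lambda>j k. v j k \<oplus>\<^bsub>N\<^esub> c j \<odot>\<^bsub>N\<^esub> w k)"
  have v'cl: "v' j k \<in> carrier N" if "j \<in> J'" "k \<le> n" for j k
    using that c(1) wcl vcl' by (simp add: v'_def)
  \<comment> \<open>One scalar \<open>b\<close>, minus the sum of the
    \<open>a j \<otimes> c j\<close>, serves all coordinates \<open>k\<close> at once. General
    subsets \<open>I\<close> are there for the induction.\<close>
  have rewrite: "\<exists>b\<in>carrier R. \<forall>k\<le>n. (\<Oplus>\<^bsub>N\<^esub>j\<in>I. a j \<odot>\<^bsub>N\<^esub> v j k) =
      (\<Oplus>\<^bsub>N\<^esub>j\<in>I. a j \<odot>\<^bsub>N\<^esub> v' j k) \<oplus>\<^bsub>N\<^esub> b \<odot>\<^bsub>N\<^esub> w k"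
    if "finite I" "I \<subseteq> J'" "a \<in> J' \<rightarrow> carrier R" for I a
    using that
  proof (induction I)
    case empty
    show ?case by (rule bexI[of _ \<zero>]) (auto simp: wcl)
  next
    case (insert i I)
    then obtain b where b: "b \<in> carrier R" "\<forall>k\<le>n. (\<Oplus>\<^bsub>N\<^esub>j\<in>I. a j \<odot>\<^bsub>N\<^esub> v j k) =
      (\<Oplus>\<^bsub>N\<^esub>j\<in>I. a j \<odot>\<^bsub>N\<^esub> v' j k) \<oplus>\<^bsub>N\<^esub> b \<odot>\<^bsub>N\<^esub> w k" by auto
    have i: "i \<in> J'" "a i \<in> carrier R" "c i \<in> carrier R" using insert.prems c by auto
    show ?case
    proof (intro bexI[of _ "b \<oplus> \<ominus> (a i \<otimes> c i)"] allI impI)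
      fix k assume k: "k \<le> n"
      have cl: "(\<lambda>j. a j \<odot>\<^bsub>N\<^esub> v j k) \<in> I \<rightarrow> carrier N" "(\<lambda>j. a j \<odot>\<^bsub>N\<^esub> v' j k) \<in> I \<rightarrow> carrier N"
        using insert.prems vcl' v'cl k by (auto simp: Pi_iff subset_iff)
      note cl2 = M.finsum_closed[OF cl(2)]
      have "a i \<odot>\<^bsub>N\<^esub> v i k = a i \<odot>\<^bsub>N\<^esub> v' i k \<oplus>\<^bsub>N\<^esub> (\<ominus> (a i \<otimes> c i)) \<odot>\<^bsub>N\<^esub> w k"
        using i vcl' wcl k
        by (simp add: v'_def smult_r_distr smult_l_minus smult_assoc1 M.a_assoc M.r_neg)
      thus "(\<Oplus>\<^bsub>N\<^esub>j\<in>insert i I. a j \<odot>\<^bsub>N\<^esub> v j k) = (\<Oplus>\<^bsub>N\<^esub>j\<in>insert i I. a j \<odot>\<^bsub>N\<^esub> v' j k)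
          \<oplus>\<^bsub>N\<^esub> (b \<oplus> \<ominus> (a i \<otimes> c i)) \<odot>\<^bsub>N\<^esub> w k"
        using insert.hyps i b cl cl2 k vcl' v'cl wcl by (simp add: smult_l_distr M.a_ac)
    qed (use b i in auto)
  qed
  have "n \<le> card J'"
  proof (rule Suc.IH[of J' v'])
    fix u :: "nat \<Rightarrow> _" assume u: "\<And>k. k < n \<Longrightarrow> u k \<in> carrier N"
    \<comment> \<open>Prescribing zero as the last coordinate of the target will force the
      contribution of the pivot \<open>w\<close> to vanish modulo \<open>H\<close>.\<close>
    have "(u(n := \<zero>\<^bsub>N\<^esub>)) k \<in> carrier N" if "k < Suc n" for k
      using u that by (auto simp: less_Suc_eq)
    from span[of "u(n := \<zero>\<^bsub>N\<^esub>)", OF this] obtain a where a: "a \<in> J \<rightarrow> carrier R" and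
      eq: "\<forall>k<Suc n. \<exists>h\<in>H. (u(n := \<zero>\<^bsub>N\<^esub>)) k = (\<Oplus>\<^bsub>N\<^esub>j\<in>J. a j \<odot>\<^bsub>N\<^esub> v j k) \<oplus>\<^bsub>N\<^esub> h"
      by blast
    have aJ': "a \<in> J' \<rightarrow> carrier R" "a j0 \<in> carrier R" using a J' by auto
    obtain b where b: "b \<in> carrier R" "\<forall>k\<le>n. (\<Oplus>\<^bsub>N\<^esub>j\<in>J'. a j \<odot>\<^bsub>N\<^esub> v j k) =
      (\<Oplus>\<^bsub>N\<^esub>j\<in>J'. a j \<odot>\<^bsub>N\<^esub> v' j k) \<oplus>\<^bsub>N\<^esub> b \<odot>\<^bsub>N\<^esub> w k"
      using rewrite[OF J'(1) subset_refl aJ'(1)] by auto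
    \<comment> \<open>The total coefficient of \<open>w\<close>: its own, plus what the passage from
      \<open>v\<close> to \<open>v'\<close> collects.\<close>
    define d where "d = a j0 \<oplus> b"
    have d: "d \<in> carrier R" using aJ' b by (simp add: d_def)
    have Scl: "(\<Oplus>\<^bsub>N\<^esub>j\<in>J'. a j \<odot>\<^bsub>N\<^esub> v' j k) \<in> carrier N" if "k \<le> n" for k
      using aJ' v'cl that by (intro M.finsum_closed) auto
    have sum_eq: "(\<Oplus>\<^bsub>N\<^esub>j\<in>J. a j \<odot>\<^bsub>N\<^esub> v j k) =
        (\<Oplus>\<^bsub>N\<^esub>j\<in>J'. a j \<odot>\<^bsub>N\<^esub> v' j k) \<oplus>\<^bsub>N\<^esub> d \<odot>\<^bsub>N\<^esub> w k" if k: "k \<le> n" for k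
    proof -
      have "(\<lambda>j. a j \<odot>\<^bsub>N\<^esub> v j k) \<in> J' \<rightarrow> carrier N" using aJ' vcl' k by auto
      hence "(\<Oplus>\<^bsub>N\<^esub>j\<in>J. a j \<odot>\<^bsub>N\<^esub> v j k) = a j0 \<odot>\<^bsub>N\<^esub> w k \<oplus>\<^bsub>N\<^esub> (\<Oplus>\<^bsub>N\<^esub>j\<in>J'. a j \<odot>\<^bsub>N\<^esub> v j k)"
        using J' aJ' wcl k by (simp add: w_def)
      thus ?thesis using b aJ' wcl k Scl[OF k] by (simp add: d_def smult_l_distr M.a_ac)
    qed
    obtain h where h: "h \<in> H" "\<zero>\<^bsub>N\<^esub> =
        ((\<Oplus>\<^bsub>N\<^esub>j\<in>J'. a j \<odot>\<^bsub>N\<^esub> v' j n) \<oplus>\<^bsub>N\<^esub> d \<odot>\<^bsub>N\<^esub> w n) \<oplus>\<^bsub>N\<^esub> h"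
      using eq sum_eq[of n] by auto
    have Sn: "(\<Oplus>\<^bsub>N\<^esub>j\<in>J'. a j \<odot>\<^bsub>N\<^esub> v' j n) \<in> H"
      using aJ' c by (intro finsum_mem) (auto simp: v'_def Pi_iff)
    have "d \<odot>\<^bsub>N\<^esub> w n \<in> H"
    proof (rule add_mem_cancel)
      show "h \<oplus>\<^bsub>N\<^esub> (\<Oplus>\<^bsub>N\<^esub>j\<in>J'. a j \<odot>\<^bsub>N\<^esub> v' j n) \<in> H" using h Sn by simp
      have "(h \<oplus>\<^bsub>N\<^esub> (\<Oplus>\<^bsub>N\<^esub>j\<in>J'. a j \<odot>\<^bsub>N\<^esub> v' j n)) \<oplus>\<^bsub>N\<^esub> d \<odot>\<^bsub>N\<^esub> w n = \<zero>\<^bsub>N\<^esub>"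
        using h Scl[of n] d wcl by (simp add: M.a_ac)
      thus "(h \<oplus>\<^bsub>N\<^esub> (\<Oplus>\<^bsub>N\<^esub>j\<in>J'. a j \<odot>\<^bsub>N\<^esub> v' j n)) \<oplus>\<^bsub>N\<^esub> d \<odot>\<^bsub>N\<^esub> w n \<in> H" by simp
    qed (use d wcl in auto)
    \<comment> \<open>As \<open>w n\<close> is nonzero modulo \<open>H\<close>, a scalar killing it
      there kills every coordinate of \<open>w\<close>. So \<open>w\<close> can be omitted, and the
      coefficients \<open>a\<close> already work for \<open>v'\<close>.\<close>
    hence dw: "d \<odot>\<^bsub>N\<^esub> w k \<in> H" if "k \<le> n" for k
      using smult_mem_all[of "w n" d "w k"] j0 d wcl that by (simp add: w_def)
    have "\<exists>h\<in>H. u k = (\<Oplus>\<^bsub>N\<^esub>j\<in>J'. a j \<odot>\<^bsub>N\<^esub> v' j k) \<oplus>\<^bsub>N\<^esub> h" if k: "k < n" for k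
    proof -
      obtain h where h: "h \<in> H" "u k = (\<Oplus>\<^bsub>N\<^esub>j\<in>J. a j \<odot>\<^bsub>N\<^esub> v j k) \<oplus>\<^bsub>N\<^esub> h"
        using eq[rule_format, of k] k by auto
      thus ?thesis using dw[of k] k sum_eq[of k] Scl[of k]
        by (intro bexI[of _ "d \<odot>\<^bsub>N\<^esub> w k \<oplus>\<^bsub>N\<^esub> h"]) (auto simp: M.a_assoc)
    qed
    thus "\<exists>a\<in>J' \<rightarrow> carrier R. \<forall>k<n. \<exists>h\<in>H. u k = (\<Oplus>\<^bsub>N\<^esub>j\<in>J'. a j \<odot>\<^bsub>N\<^esub> v' j k) \<oplus>\<^bsub>N\<^esub> h"
      using aJ' by blast
  qed (use J' v'cl in auto)
  thus ?case using J' by simp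
qed simp

end

section \<open>Linear combinations and generators of powers\<close>

lemma linear_maps_iff:
  "f \<in> linear_maps R M N \<longleftrightarrow>
    (\<forall>x\<in>carrier M. f x \<in> carrier N) \<and>
    (\<forall>x\<in>carrier M. \<forall>y\<in>carrier M. f (x \<oplus>\<^bsub>M\<^esub> y) = f x \<oplus>\<^bsub>N\<^esub> f y) \<and>
    (\<forall>a\<in>carrier R. \<forall>x\<in>carrier M. f (a \<odot>\<^bsub>M\<^esub> x) = a \<odot>\<^bsub>N\<^esub> f x)"
  by (auto simp: linear_maps_def hom_def)

text \<open>The combinations of \<open>A\<close> form a submodule containing \<open>A\<close>, hence
  contain the intersection that defines \<open>submodule_generated\<close>.\<close>

lemma (in module) ex_eq_linear_combination:
  assumes "finite A" "A \<subseteq> carrier M" and gen: "carrier M = submodule_generated R M A"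
    and "y \<in> carrier M"
  shows "\<exists>a\<in>A \<rightarrow> carrier R. y = (\<Oplus>\<^bsub>M\<^esub>x\<in>A. a x \<odot>\<^bsub>M\<^esub> x)"
proof -
  let ?c = "\<lambda>a. \<Oplus>\<^bsub>M\<^esub>x\<in>A. a x \<odot>\<^bsub>M\<^esub> x"
  let ?K = "?c ` (A \<rightarrow> carrier R)"
  have cl: "(\<lambda>x. a x \<odot>\<^bsub>M\<^esub> x) \<in> A \<rightarrow> carrier M" if "a \<in> A \<rightarrow> carrier R" for a
    using that assms(2) by auto
  have smult: "b \<odot>\<^bsub>M\<^esub> ?c a = ?c (\<lambda>x. b \<otimes> a x)" if "a \<in> A \<rightarrow> carrier R" "b \<in> carrier R" for a b
  proof -
    have "b \<odot>\<^bsub>M\<^esub> ?c a = (\<Oplus>\<^bsub>M\<^esub>x\<in>A. b \<odot>\<^bsub>M\<^esub> (a x \<odot>\<^bsub>M\<^esub> x))"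
      using that cl[OF that(1)] assms(1) by (intro finsum_smult_ldistr) auto
    also have "\<dots> = ?c (\<lambda>x. b \<otimes> a x)"
      using that assms(2) by (intro M.finsum_cong') (auto simp: smult_assoc1 Pi_iff subset_iff)
    finally show ?thesis .
  qed
  have "submodule ?K R M"
  proof (rule submoduleI)
    show "?K \<subseteq> carrier M" using cl by (auto intro!: M.finsum_closed)
    have "?c (\<lambda>_. \<zero>) = \<zero>\<^bsub>M\<^esub>"
      using assms(2) by (intro M.add.finprod_one_eqI) auto
    thus "\<zero>\<^bsub>M\<^esub> \<in> ?K" by (intro image_eqI[of _ _ "\<lambda>_. \<zero>"]) auto
    show sm: "b \<odot>\<^bsub>M\<^esub> y \<in> ?K" if "b \<in> carrier R" "y \<in> ?K" for b y
      using that smult by (force intro!: image_eqI)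
    show "\<ominus>\<^bsub>M\<^esub> y \<in> ?K" if "y \<in> ?K" for y
    proof -
      have "y \<in> carrier M" using that cl by (auto intro!: M.finsum_closed)
      hence "(\<ominus> \<one>) \<odot>\<^bsub>M\<^esub> y = \<ominus>\<^bsub>M\<^esub> y" by (simp add: smult_l_minus)
      thus ?thesis using sm[OF _ that, of "\<ominus> \<one>"] by simp
    qed
    show "y \<oplus>\<^bsub>M\<^esub> z \<in> ?K" if "y \<in> ?K" "z \<in> ?K" for y z
    proof -
      from that(1) obtain a where a: "a \<in> A \<rightarrow> carrier R" "y = ?c a" by blast
      from that(2) obtain b where b: "b \<in> A \<rightarrow> carrier R" "z = ?c b" by blast
      note ab = a b
      have "y \<oplus>\<^bsub>M\<^esub> z = (\<Oplus>\<^bsub>M\<^esub>x\<in>A. a x \<odot>\<^bsub>M\<^esub> x \<oplus>\<^bsub>M\<^esub> b x \<odot>\<^bsub>M\<^esub> x)"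
        using ab cl by (simp add: M.finsum_addf)
      also have "\<dots> = ?c (\<lambda>x. a x \<oplus> b x)"
        using ab assms(2) by (intro M.finsum_cong') (auto simp: smult_l_distr Pi_iff subset_iff)
      finally show ?thesis using ab by (intro image_eqI[of _ _ "\<lambda>x. a x \<oplus> b x"]) auto
    qed
  qed
  moreover have "A \<subseteq> ?K"
  proof
    fix x assume x: "x \<in> A"
    have "?c (\<lambda>z. if z = x then \<one> else \<zero>) = (\<Oplus>\<^bsub>M\<^esub>z\<in>A. if z = x then z else \<zero>\<^bsub>M\<^esub>)"
      using assms(2) by (intro M.finsum_cong') auto
    also have "\<dots> = x"
      using x assms(1,2) by (intro M.add.finprod_singleton_swap) auto
    finally show "x \<in> ?K" by (intro image_eqI[of _ _ "\<lambda>z. if z = x then \<one> else \<zero>"]) auto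
  qed
  ultimately have "carrier M \<subseteq> ?K" using gen by (auto simp: submodule_generated_def)
  thus ?thesis using assms(4) by auto
qed

text \<open>The inclusion of \<open>M\<close> as the \<open>i\<close>-th summand; the restriction to
  \<open>{..<r}\<close> makes the tuple extensional, as \<open>module_power\<close> demands.\<close>

definition unit_tuple :: "('a, 'b, 'm) module_scheme \<Rightarrow> nat \<Rightarrow> nat \<Rightarrow> 'b \<Rightarrow> nat \<Rightarrow> 'b"
  where "unit_tuple M r i x = (\<lambda>l\<in>{..<r}. if l = i then x else \<zero>\<^bsub>M\<^esub>)"

text \<open>Supplies at most \<open>r * card A\<close> generators of the power when \<open>A\<close>
  is finite. A submodule containing them contains each summand, and therefore every finite sum of
  coordinate tuples.\<close>

lemma module_power_generated:
  fixes r :: nat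
  assumes "module R M" and A: "A \<subseteq> carrier M" "carrier M = submodule_generated R M A"
  defines "B \<equiv> (\<lambda>(i, x). unit_tuple M r i x) ` ({..<r} \<times> A)"
  shows "B \<subseteq> carrier (module_power M r)"
    and "carrier (module_power M r) = submodule_generated R (module_power M r) B"
proof -
  interpret module R M by fact
  interpret P: module R "module_power M r" by (rule module_module_power) fact
  show B: "B \<subseteq> carrier (module_power M r)"
    using A(1) by (auto simp: B_def module_power_def unit_tuple_def split: if_splits)
  have "m \<in> K" if K: "submodule K R (module_power M r)" "B \<subseteq> K"
    and m: "m \<in> carrier (module_power M r)" for K m
  proof -
    note K' = P.submoduleE[OF K(1)]
    have zero: "(\<lambda>i\<in>{..<r}. \<zero>\<^bsub>M\<^esub>) \<in> K"
      using subgroup.one_closed[OF submodule.axioms(1)[OF K(1)]] by (simp add: module_power_def)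
    have unit: "unit_tuple M r i x \<in> K" if "i < r" "x \<in> carrier M" for i x
    proof -
      \<comment> \<open>The preimage of \<open>K\<close> under the \<open>i\<close>-th inclusion is
        a submodule of \<open>M\<close> that contains \<open>A\<close>, so it is everything.\<close>
      let ?K = "{x \<in> carrier M. unit_tuple M r i x \<in> K}"
      have "submodule ?K R M"
      proof (rule submoduleI)
        show "\<zero>\<^bsub>M\<^esub> \<in> ?K" using zero by (simp add: unit_tuple_def cong: if_cong)
        show sm: "a \<odot>\<^bsub>M\<^esub> y \<in> ?K" if "a \<in> carrier R" "y \<in> ?K" for a y
        proof -
          have "unit_tuple M r i (a \<odot>\<^bsub>M\<^esub> y) = a \<odot>\<^bsub>module_power M r\<^esub> unit_tuple M r i y"
            using that by (auto simp: unit_tuple_def module_power_def)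
          thus ?thesis using that K'(4) by simp
        qed
        show "\<ominus>\<^bsub>M\<^esub> y \<in> ?K" if "y \<in> ?K" for y
          using sm[OF _ that, of "\<ominus>\<^bsub>R\<^esub> \<one>\<^bsub>R\<^esub>"] that by (simp add: smult_l_minus)
        show "y \<oplus>\<^bsub>M\<^esub> z \<in> ?K" if "y \<in> ?K" "z \<in> ?K" for y z
        proof -
          have "unit_tuple M r i (y \<oplus>\<^bsub>M\<^esub> z) =
              unit_tuple M r i y \<oplus>\<^bsub>module_power M r\<^esub> unit_tuple M r i z"
            using that by (auto simp: unit_tuple_def module_power_def)
          thus ?thesis using that K'(5) by simp
        qed
      qed auto
      moreover have "A \<subseteq> ?K" using A(1) K(2) \<open>i < r\<close> by (auto simp: B_def)
      ultimately have "carrier M \<subseteq> ?K"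
        using A(2) unfolding submodule_generated_def by blast
      thus ?thesis using that by auto
    qed
    \<comment> \<open>The tuple \<open>m\<close> is built up one coordinate at a time;
      \<open>s\<close> counts the coordinates already filled in.\<close>
    have "(\<lambda>l\<in>{..<r}. if l < s then m l else \<zero>\<^bsub>M\<^esub>) \<in> K" if "s \<le> r" for s
      using that
    proof (induction s)
      case 0
      show ?case using zero by (simp add: restrict_def)
    next
      case (Suc s)
      have "m s \<in> carrier M" using m Suc.prems by (auto simp: module_power_def PiE_iff)
      moreover have "(\<lambda>l\<in>{..<r}. if l < Suc s then m l else \<zero>\<^bsub>M\<^esub>) =
          (\<lambda>l\<in>{..<r}. if l < s then m l else \<zero>\<^bsub>M\<^esub>) \<oplus>\<^bsub>module_power M r\<^esub> unit_tuple M r s (m s)"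
        using m by (auto simp: module_power_def unit_tuple_def PiE_iff less_Suc_eq)
      moreover have "(\<lambda>l\<in>{..<r}. if l < s then m l else \<zero>\<^bsub>M\<^esub>) \<in> K"
        by (rule Suc.IH) (use Suc.prems in simp)
      ultimately show ?case using Suc.prems K'(5) unit[of s "m s"] by (simp only: Suc_le_eq)
    qed
    from this[of r] have "(\<lambda>l\<in>{..<r}. if l < r then m l else \<zero>\<^bsub>M\<^esub>) \<in> K" by simp
    also have "(\<lambda>l\<in>{..<r}. if l < r then m l else \<zero>\<^bsub>M\<^esub>) = m"
      using m by (auto simp: module_power_def PiE_iff extensional_def)
    finally show ?thesis .
  qed
  moreover have "submodule_generated R (module_power M r) B \<subseteq> carrier (module_power M r)"
    using P.carrier_is_submodule B by (auto simp: submodule_generated_def)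
  ultimately show "carrier (module_power M r) = submodule_generated R (module_power M r) B"
    by (auto simp: submodule_generated_def)
qed

section \<open>The bound for surjections onto powers\<close>

text \<open>Reading off one coordinate turns the image of a combination into a sum in
  \<open>N\<close> itself, the form needed for congruences modulo \<open>H\<close>.\<close>

lemma linear_map_finsum_nth:
  assumes "module R L" "module R N" and f: "f \<in> linear_maps R L (module_power N n)"
    and k: "k < n" and J: "finite J" "J \<subseteq> carrier L" "a \<in> J \<rightarrow> carrier R"
  shows "f (\<Oplus>\<^bsub>L\<^esub>x\<in>J. a x \<odot>\<^bsub>L\<^esub> x) k = (\<Oplus>\<^bsub>N\<^esub>x\<in>J. a x \<odot>\<^bsub>N\<^esub> f x k)"
proof -
  interpret L: module R L by fact
  interpret N: module R N by fact
  have fcl: "f x k \<in> carrier N" if "x \<in> carrier L" for x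
    using f that k by (auto simp: linear_maps_iff module_power_def PiE_iff)
  have add: "f (x \<oplus>\<^bsub>L\<^esub> y) k = f x k \<oplus>\<^bsub>N\<^esub> f y k" if "x \<in> carrier L" "y \<in> carrier L" for x y
    using f that k by (simp add: linear_maps_iff module_power_def)
  have smult: "f (b \<odot>\<^bsub>L\<^esub> x) k = b \<odot>\<^bsub>N\<^esub> f x k" if "x \<in> carrier L" "b \<in> carrier R" for x b
    using f that k by (simp add: linear_maps_iff module_power_def)
  show ?thesis using J
  proof (induction J)
    case empty
    \<comment> \<open>\<open>linear_maps\<close> does not list preservation of zero; it follows from
      homogeneity with the scalar zero.\<close>
    show ?case using smult[of "\<zero>\<^bsub>L\<^esub>" "\<zero>\<^bsub>R\<^esub>"] fcl by simp
  next
    case (insert i J)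
    have "(\<lambda>x. a x \<odot>\<^bsub>L\<^esub> x) \<in> J \<rightarrow> carrier L" "(\<lambda>x. a x \<odot>\<^bsub>N\<^esub> f x k) \<in> J \<rightarrow> carrier N"
      using insert.prems fcl by (auto simp: Pi_iff subset_iff)
    thus ?case using insert fcl by (simp add: add smult)
  qed
qed

text \<open>The images of the generators span the power of \<open>N\<close> exactly, hence also
  modulo \<open>H\<close>, with error term zero; the dimension count then applies with index set
  \<open>A\<close>.\<close>

lemma (in maximal_submodule) surjection_onto_power_le:
  assumes "module R L" "finite A" "A \<subseteq> carrier L" "carrier L = submodule_generated R L A"
    and f: "f \<in> linear_maps R L (module_power N n)"
    and surj: "f ` carrier L = carrier (module_power N n)"
  shows "n \<le> card A"
proof (rule card_ge_if_spanning[OF assms(2)])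
  interpret L: module R L by fact
  show fcl: "f x k \<in> carrier N" if "x \<in> A" "k < n" for x k
    using f that assms(3) by (auto simp: linear_maps_iff module_power_def PiE_iff)
  fix u :: "nat \<Rightarrow> _" assume "\<And>k. k < n \<Longrightarrow> u k \<in> carrier N"
  hence "restrict u {..<n} \<in> f ` carrier L" by (simp add: surj module_power_def)
  then obtain y where y: "y \<in> carrier L" "f y = restrict u {..<n}" by auto
  obtain a where a: "a \<in> A \<rightarrow> carrier R" "y = (\<Oplus>\<^bsub>L\<^esub>x\<in>A. a x \<odot>\<^bsub>L\<^esub> x)"
    using L.ex_eq_linear_combination[OF assms(2-4) y(1)] by auto
  have "u k = (\<Oplus>\<^bsub>N\<^esub>x\<in>A. a x \<odot>\<^bsub>N\<^esub> f x k) \<oplus>\<^bsub>N\<^esub> \<zero>\<^bsub>N\<^esub>" if "k < n" for k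
  proof -
    have "(\<Oplus>\<^bsub>N\<^esub>x\<in>A. a x \<odot>\<^bsub>N\<^esub> f x k) \<in> carrier N"
      using a fcl that by (intro M.finsum_closed) auto
    thus ?thesis
      using y a that linear_map_finsum_nth[OF assms(1) module_axioms f that assms(2,3) a(1)]
      by (simp add: fun_eq_iff)
  qed
  thus "\<exists>a\<in>A \<rightarrow> carrier R. \<forall>k<n. \<exists>h\<in>H. u k = (\<Oplus>\<^bsub>N\<^esub>x\<in>A. a x \<odot>\<^bsub>N\<^esub> f x k) \<oplus>\<^bsub>N\<^esub> h"
    using a by (intro bexI[of _ a]) auto
qed

section \<open>Direct sums of surjections\<close>

lemma surjection_append:
  fixes R :: "('a, 'r) ring_scheme"
    and M :: "('a, 'b, 'm) module_scheme"
    and N :: "('a, 'c, 'n) module_scheme"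
  assumes f: "f \<in> linear_maps R (module_power M r) (module_power N n)"
      "f ` carrier (module_power M r) = carrier (module_power N n)"
    and g: "g \<in> linear_maps R (module_power M s) (module_power N m)"
      "g ` carrier (module_power M s) = carrier (module_power N m)"
  shows "\<exists>h\<in>linear_maps R (module_power M (r + s)) (module_power N (n + m)).
    h ` carrier (module_power M (r + s)) = carrier (module_power N (n + m))"
proof
  \<comment> \<open>\<open>p\<close> and \<open>q\<close> project onto the first \<open>r\<close>
    and the last \<open>s\<close> coordinates, and \<open>h\<close> is the direct sum of
    \<open>f\<close> and \<open>g\<close> along this splitting.\<close>
  define p where "p = (\<lambda>u. restrict u {..<r} :: nat \<Rightarrow> 'b)"
  define q where "q = (\<lambda>u. \<lambda>i\<in>{..<s}. u (r + i) :: 'b)"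
  define h where "h = (\<lambda>u. \<lambda>k\<in>{..<n + m}. if k < n then f (p u) k else g (q u) (k - n))"
  have p: "p u \<in> carrier (module_power M r)" if "u \<in> carrier (module_power M (r + s))" for u
    using that by (auto simp: p_def module_power_def PiE_iff)
  have q: "q u \<in> carrier (module_power M s)" if "u \<in> carrier (module_power M (r + s))" for u
    using that by (auto simp: q_def module_power_def PiE_iff)
  have padd: "p (u \<oplus>\<^bsub>module_power M (r + s)\<^esub> v) = p u \<oplus>\<^bsub>module_power M r\<^esub> p v"
    and psmult: "p (a \<odot>\<^bsub>module_power M (r + s)\<^esub> u) = a \<odot>\<^bsub>module_power M r\<^esub> p u" for a u v
    by (auto simp: p_def module_power_def)
  have qadd: "q (u \<oplus>\<^bsub>module_power M (r + s)\<^esub> v) = q u \<oplus>\<^bsub>module_power M s\<^esub> q v"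
    and qsmult: "q (a \<odot>\<^bsub>module_power M (r + s)\<^esub> u) = a \<odot>\<^bsub>module_power M s\<^esub> q u" for a u v
    by (auto simp: q_def module_power_def)
  have fp: "f (p u) k \<in> carrier N" if "u \<in> carrier (module_power M (r + s))" "k < n" for u k
    using f(1) p that by (auto simp: linear_maps_iff module_power_def[of N] PiE_iff)
  have gq: "g (q u) k \<in> carrier N" if "u \<in> carrier (module_power M (r + s))" "k < m" for u k
    using g(1) q that by (auto simp: linear_maps_iff module_power_def[of N] PiE_iff)
  have h_carrier: "h u \<in> carrier (module_power N (n + m))"
    if "u \<in> carrier (module_power M (r + s))" for u
    using that fp gq by (auto simp: h_def module_power_def[of N])
  show "h \<in> linear_maps R (module_power M (r + s)) (module_power N (n + m))"
    unfolding linear_maps_iff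
  proof (intro conjI ballI h_carrier)
    fix u v
    assume u: "u \<in> carrier (module_power M (r + s))" and v: "v \<in> carrier (module_power M (r + s))"
    have "f (p u \<oplus>\<^bsub>module_power M r\<^esub> p v) = f (p u) \<oplus>\<^bsub>module_power N n\<^esub> f (p v)"
      "g (q u \<oplus>\<^bsub>module_power M s\<^esub> q v) = g (q u) \<oplus>\<^bsub>module_power N m\<^esub> g (q v)"
      using f(1) g(1) p[OF u] p[OF v] q[OF u] q[OF v] by (auto simp: linear_maps_iff)
    thus "h (u \<oplus>\<^bsub>module_power M (r + s)\<^esub> v) = h u \<oplus>\<^bsub>module_power N (n + m)\<^esub> h v"
      by (auto simp: h_def padd qadd module_power_def[of N] intro!: ext)
  next
    fix a u assume a: "a \<in> carrier R" and u: "u \<in> carrier (module_power M (r + s))"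
    have "f (a \<odot>\<^bsub>module_power M r\<^esub> p u) = a \<odot>\<^bsub>module_power N n\<^esub> f (p u)"
      "g (a \<odot>\<^bsub>module_power M s\<^esub> q u) = a \<odot>\<^bsub>module_power N m\<^esub> g (q u)"
      using f(1) g(1) p[OF u] q[OF u] a by (auto simp: linear_maps_iff)
    thus "h (a \<odot>\<^bsub>module_power M (r + s)\<^esub> u) = a \<odot>\<^bsub>module_power N (n + m)\<^esub> h u"
      by (auto simp: h_def psmult qsmult module_power_def[of N] intro!: ext)
  qed
  show "h ` carrier (module_power M (r + s)) = carrier (module_power N (n + m))"
  proof (intro equalityI subsetI)
    fix z assume z: "z \<in> carrier (module_power N (n + m))"
    have zk: "z k \<in> carrier N" if "k < n + m" for k
      using z that by (simp add: module_power_def PiE_iff)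
    have "restrict z {..<n} \<in> f ` carrier (module_power M r)"
      unfolding f(2) using zk by (simp add: module_power_def restrict_PiE_iff)
    then obtain x where x: "x \<in> carrier (module_power M r)" "f x = restrict z {..<n}"
      by auto
    have "(\<lambda>k\<in>{..<m}. z (n + k)) \<in> g ` carrier (module_power M s)"
      unfolding g(2) using zk by (simp add: module_power_def restrict_PiE_iff)
    then obtain y where y: "y \<in> carrier (module_power M s)" "g y = (\<lambda>k\<in>{..<m}. z (n + k))"
      by auto
    \<comment> \<open>A preimage of \<open>z\<close> is the concatenation of preimages of its two
      pieces.\<close>
    define u where "u = (\<lambda>i\<in>{..<r + s}. if i < r then x i else y (i - r))"
    have "x i \<in> carrier M" if "i < r" for i
      using x(1) that by (simp add: module_power_def PiE_iff)
    moreover have "y i \<in> carrier M" if "i < s" for i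
      using y(1) that by (simp add: module_power_def PiE_iff)
    ultimately have u: "u \<in> carrier (module_power M (r + s))"
      by (simp add: u_def module_power_def restrict_PiE_iff)
    have "p u = x"
    proof
      show "p u i = x i" for i
        using x(1) by (cases "i < r")
          (simp_all add: p_def u_def module_power_def PiE_iff extensional_def)
    qed
    moreover have "q u = y"
    proof
      show "q u i = y i" for i
        using y(1) by (cases "i < s")
          (simp_all add: q_def u_def module_power_def PiE_iff extensional_def)
    qed
    \<comment> \<open>For \<open>k \<ge> n + m\<close> both sides are \<open>undefined\<close>,
      since both tuples are extensional.\<close>
    ultimately have "h u k = z k" for k
      using x(2) y(2) z by (cases "k < n + m")
        (simp_all add: h_def module_power_def PiE_iff extensional_def)
    hence "h u = z" ..
    thus "z \<in> h ` carrier (module_power M (r + s))" using u by blast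
  qed (use h_carrier in auto)
qed

section \<open>Convergence of the normalized surjective numbers\<close>

theorem lemma2p7:
  fixes R :: "('a, 'r) ring_scheme"
    and M :: "('a, 'b, 'm) module_scheme"
    and N :: "('a, 'c, 'n) module_scheme"
  assumes "cring R" and "noetherian_ring R"
    and "module R M" and "finitely_generated_module R M"
    and "module R N" and "finitely_generated_module R N"
    and "carrier N \<noteq> {\<zero>\<^bsub>N\<^esub>}"
  shows "\<exists>L::real.
    (\<lambda>r. ereal_of_enat (surj_number R N (module_power M r)) / ereal (real r)) \<longlonglongrightarrow> ereal L"
proof -
  interpret N: module R N by fact
  interpret M: module R M by fact
  obtain H where "submodule H R N" "H \<noteq> carrier N"
    "\<And>K. submodule K R N \<Longrightarrow> H \<subset> K \<Longrightarrow> K = carrier N"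
    using ex_maximal_submodule[OF assms(5-7)] by metis
  then interpret maximal_submodule R N H
    by (intro maximal_submodule.intro maximal_submodule_axioms.intro assms(5))
  obtain A where A: "finite A" "A \<subseteq> carrier M" "carrier M = submodule_generated R M A"
    using assms(4) by (auto simp: finitely_generated_module_def)
  define S where "S r = {n. \<exists>f\<in>linear_maps R (module_power M r) (module_power N n).
    f ` carrier (module_power M r) = carrier (module_power N n)}" for r
  have bound: "n \<le> r * card A" if "n \<in> S r" for r n
  proof -
    let ?B = "(\<lambda>(i, x). unit_tuple M r i x) ` ({..<r} \<times> A)"
    obtain f where "f \<in> linear_maps R (module_power M r) (module_power N n)"
      "f ` carrier (module_power M r) = carrier (module_power N n)"
      using \<open>n \<in> S r\<close> by (auto simp: S_def)
    hence "n \<le> card ?B"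
      using module_power_generated[OF assms(3) A(2,3), of r] A(1)
      by (intro surjection_onto_power_le[OF module_module_power[OF assms(3), of r]]) auto
    \<comment> \<open>Only an inequality: distinct pairs may give the same tuple, for instance when
      \<open>A\<close> contains zero.\<close>
    also have "\<dots> \<le> card ({..<r} \<times> A)" using A(1) by (intro card_image_le) auto
    finally show ?thesis by (simp add: card_cartesian_product)
  qed
  hence fin: "finite (S r)" for r by (meson finite_nat_set_iff_bounded_le)
  \<comment> \<open>The zeroth power of \<open>N\<close> has a single element, the everywhere
    \<open>undefined\<close> function, so the constant map onto it is surjective. Thus
    \<open>S r\<close> is nonempty and has a maximum.\<close>
  have zero_map: "(\<lambda>_ _. undefined) \<in> linear_maps R (module_power M r) (module_power N 0)"
    "(\<lambda>_ _. undefined) ` carrier (module_power M r) = carrier (module_power N 0)" for r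
    using abelian_groupE(2)[OF module.axioms(2)[OF module_module_power[OF assms(3), of r]]]
    by (auto simp: linear_maps_iff module_power_def[of N] restrict_def)
  have "0 \<in> S r" for r
    unfolding S_def by (rule CollectI, rule bexI, rule zero_map(2), rule zero_map(1))
  hence ne: "S r \<noteq> {}" for r by (metis empty_iff)
  define a where "a r = Max (S r)" for r
  have a: "a r \<in> S r" for r unfolding a_def by (rule Max_in[OF fin ne])
  have "a r + a s \<in> S (r + s)" for r s
    using a[of r] a[of s] unfolding S_def by (elim CollectE bexE, intro CollectI surjection_append)
  hence superadd: "a r + a s \<le> a (r + s)" for r s
    unfolding a_def[of "r + s"] by (intro Max_ge fin)
  obtain L where L: "(\<lambda>r. real (a r) / real r) \<longlonglongrightarrow> L"
    using superadditive_convergent[of a, OF superadd bound[OF a]] ..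
  have surj_number_eq: "surj_number R N (module_power M r) = enat (a r)" for r
  proof -
    \<comment> \<open>The supremum in \<open>enat\<close> is attained, \<open>S r\<close> being
      finite and nonempty, so the surjective number is a natural number.\<close>
    have "surj_number R N (module_power M r) = Sup (enat ` S r)"
      unfolding surj_number_def S_def by (rule arg_cong[where f = Sup]) auto
    also have "\<dots> = enat (a r)"
      using a Max_ge[OF fin] by (intro Sup_eqI) (auto simp: a_def)
    finally show ?thesis .
  qed
  \<comment> \<open>Restricting to \<open>r > 0\<close> avoids comparing the conventions for
    division by zero in \<open>real\<close> and \<open>ereal\<close>.\<close>
  have "\<forall>\<^sub>F r in sequentially. ereal (real (a r) / real r) =
      ereal_of_enat (surj_number R N (module_power M r)) / ereal (real r)"
    using eventually_gt_at_top[of 0] by eventually_elim (simp add: surj_number_eq)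
  moreover have "(\<lambda>r. ereal (real (a r) / real r)) \<longlonglongrightarrow> ereal L" using L by simp
  ultimately have "(\<lambda>r. ereal_of_enat (surj_number R N (module_power M r)) / ereal (real r))
      \<longlonglongrightarrow> ereal L"
    by (rule Lim_transform_eventually[rotated])
  thus ?thesis ..
qed

end
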